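(* Let $n\ge 1$ be an integer. A generic matrix in $\mathbb{C}^{n\times n}$ can be decomposed into a product of $2n$ tridiagonal matrices (all of size $n\times n$ with complex entries). Moreover, every invertible matrix in $\mathbb{C}^{n\times n}$ is a product of $4n$ bidiagonal matrices.
   Context: All matrices have complex entries. An $n\times n$ matrix $A=(a_{ij})$ is called bidiagonal in this convention if $a_{ij}=0$ whenever $|i-j|\ge 2$; that is, nonzero entries are allowed on the main diagonal, the first superdiagonal and the first subdiagonal (so "bidiagonal" here means the same as "tridiagonal" in the usual terminology, and the two words are used interchangeably). An algebraic subvariety of $\mathbb{C}^N$ is the zero set of finitely many polynomials. A property holds for a generic matrix in $\mathbb{C}^{n\times n}$ if there is an algebraic subvariety $Z\subsetneq \mathbb{C}^{n\times n}$ such that every matrix not having the property lies in $Z$. *)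

theory Defs
  imports Complex_Main "HOL-Library.Poly_Mapping" "Jordan_Normal_Form.Matrix"
begin

text \<open>
  A polynomial in the entries of a matrix is an element of the monoid algebra of the free
  commutative monoid on index pairs: a monomial maps each pair \<open>(i, j)\<close> (standing for the variable
  \<open>x\<^sub>i\<^sub>j\<close>) to its exponent, and a polynomial maps each monomial to its coefficient.
\<close>

type_synonym entry_poly = "((nat \<times> nat) \<Rightarrow>\<^sub>0 nat) \<Rightarrow>\<^sub>0 complex"

definition entry_poly_vars :: "entry_poly \<Rightarrow> (nat \<times> nat) set" where
  "entry_poly_vars p = (\<Union>m\<in>Poly_Mapping.keys p. Poly_Mapping.keys m)"

definition eval_entry_poly :: "entry_poly \<Rightarrow> complex mat \<Rightarrow> complex" where
  "eval_entry_poly p A =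
     (\<Sum>m\<in>Poly_Mapping.keys p. Poly_Mapping.lookup p m *
        (\<Prod>v\<in>Poly_Mapping.keys m. (A $$ v) ^ Poly_Mapping.lookup m v))"

text \<open>
  The variables are restricted to \<open>i, j < n\<close> because \<open>A $$ (i, j)\<close> is unspecified outside the
  dimensions of \<open>A\<close>.
\<close>

definition algebraic_subvariety :: "nat \<Rightarrow> complex mat set \<Rightarrow> bool" where
  "algebraic_subvariety n Z \<longleftrightarrow>
     (\<exists>P. finite P \<and> (\<forall>p\<in>P. entry_poly_vars p \<subseteq> {..<n} \<times> {..<n}) \<and>
          Z = {A \<in> carrier_mat n n. \<forall>p\<in>P. eval_entry_poly p A = 0})"

definition holds_generically :: "nat \<Rightarrow> (complex mat \<Rightarrow> bool) \<Rightarrow> bool" where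
  "holds_generically n Q \<longleftrightarrow>
     (\<exists>Z. algebraic_subvariety n Z \<and> Z \<subset> carrier_mat n n \<and>
          (\<forall>A\<in>carrier_mat n n. \<not> Q A \<longrightarrow> A \<in> Z))"

text \<open>
  ``Bidiagonal'' is used here with the same meaning as ``tridiagonal''. For natural numbers,
  \<open>\<bar>i - j\<bar> \<ge> 2\<close> is expressed on integers to avoid truncated subtraction.
\<close>

definition tridiagonal_mat :: "complex mat \<Rightarrow> bool" where
  "tridiagonal_mat A \<longleftrightarrow>
     (\<forall>i<dim_row A. \<forall>j<dim_col A. \<bar>int i - int j\<bar> \<ge> 2 \<longrightarrow> A $$ (i, j) = 0)"

abbreviation bidiagonal_mat :: "complex mat \<Rightarrow> bool" where
  "bidiagonal_mat \<equiv> tridiagonal_mat"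

definition mat_list_prod :: "nat \<Rightarrow> complex mat list \<Rightarrow> complex mat" where
  "mat_list_prod n Bs = foldr (*) Bs (1\<^sub>m n)"

definition product_of :: "nat \<Rightarrow> nat \<Rightarrow> (complex mat \<Rightarrow> bool) \<Rightarrow> complex mat \<Rightarrow> bool" where
  "product_of n k R A \<longleftrightarrow>
     (\<exists>Bs. length Bs = k \<and> (\<forall>B\<in>set Bs. B \<in> carrier_mat n n \<and> R B) \<and> A = mat_list_prod n Bs)"

end

theory Submission
  imports Defs "Jordan_Normal_Form.Determinant"
begin

text \<open>
  The factorization comes from Neville elimination, where each row is reduced by the row directly
  above it and each column by the column directly to its left. The operations are scaled so that no
  division occurs. For a matrix \<open>M\<close> of size \<open>n + 1\<close> with no zero in its first column this gives \<open>E M F = a \<oplus> M'\<close>, with \<open>E\<close> lower bidiagonal and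
  invertible, \<open>F\<close> upper bidiagonal, \<open>a\<close> the corner entry of \<open>M\<close>, and \<open>M'\<close> of size \<open>n\<close>. Inverting,
  \<open>M\<^sup>-\<^sup>1 = F (a\<^sup>-\<^sup>1 \<oplus> M'\<^sup>-\<^sup>1) E\<close>. Bordering by \<open>1\<close> keeps a matrix tridiagonal and the scalar \<open>a\<^sup>-\<^sup>1\<close> can be
  absorbed into \<open>F\<close>, so every step of the recursion costs two tridiagonal factors, and \<open>M\<^sup>-\<^sup>1\<close> is a
  product of \<open>2 n\<close> of them as soon as all pivots met on the way are nonzero
  (\<open>smult_inverse_product_if_neville_pivots\<close>). It is the inverse of the eliminated matrix that
  factors so cheaply: the inverses of \<open>E\<close> and \<open>F\<close> are full triangular matrices.

  Without divisions, \<open>M'\<close> is polynomial in \<open>M\<close>, and the product of all pivots, that is, of the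
  first columns of all matrices met, is a polynomial \<open>f\<close> in the entries of \<open>M\<close>. It does not vanish identically:
  for the Pascal matrix with entries \<open>(i + j) choose i\<close>, one step of elimination gives the
  Pascal matrix of the next smaller size.

  For the generic statement take \<open>M = adj A\<close>, which is polynomial in \<open>A\<close>: if \<open>f (adj A) \<noteq> 0\<close>, then
  \<open>adj A\<close> is invertible and \<open>adj A \<cdot> A\<close> is scalar, so \<open>A\<close> is a scalar multiple of the inverse of
  \<open>adj A\<close>.

  For an arbitrary invertible \<open>A\<close> the generic case is used twice, by the usual argument that in an
  irreducible group two dense open subsets \<open>U\<close> and \<open>V\<close> satisfy \<open>U V = G\<close>. Two nonzero polynomials
  have a common nonzero, as one sees on the line through a nonzero of each. Hence there is
  \<open>Y\<close> with \<open>f Y \<noteq> 0\<close> and \<open>f (adj Y \<cdot> A\<^sup>-\<^sup>1) \<noteq> 0\<close>, and then \<open>A = (A Y) Y\<^sup>-\<^sup>1\<close> is a product of two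
  matrices with \<open>2 n\<close> factors each.
\<close>

section \<open>Polynomial functions of the matrix entries\<close>

lemma poly_mapping_sum_single:
  fixes p :: "'a \<Rightarrow>\<^sub>0 'b::comm_monoid_add"
  shows "p = (\<Sum>m\<in>Poly_Mapping.keys p. Poly_Mapping.single m (Poly_Mapping.lookup p m))"
  by (rule poly_mapping_eqI)
    (simp add: lookup_sum lookup_single when_def sum.delta in_keys_iff)

lemma eval_entry_poly_add:
  "eval_entry_poly (p + q) A = eval_entry_poly p A + eval_entry_poly q A"
  unfolding eval_entry_poly_def
  by (rule setsum_keys_plus_distrib) (simp_all add: algebra_simps)

lemma eval_entry_poly_sum:
  "eval_entry_poly (\<Sum>i\<in>I. p i) A = (\<Sum>i\<in>I. eval_entry_poly (p i) A)"
proof (induction I rule: infinite_finite_induct)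
  case (insert i I)
  then show ?case by (simp add: eval_entry_poly_add)
qed (simp_all add: eval_entry_poly_def)

lemma eval_entry_poly_single:
  "eval_entry_poly (Poly_Mapping.single m c) A =
     c * (\<Prod>v\<in>Poly_Mapping.keys m. (A $$ v) ^ Poly_Mapping.lookup m v)"
  by (cases "c = 0") (simp_all add: eval_entry_poly_def)

text \<open>
  The two monomials and their product have different sets of variables; all three values are
  computed over the union, where the additional factors are \<open>x ^ 0 = 1\<close>.
\<close>

lemma monomial_value_add:
  fixes x :: "'v \<Rightarrow> 'b::comm_semiring_1" and m k :: "'v \<Rightarrow>\<^sub>0 nat"
  shows "(\<Prod>v\<in>Poly_Mapping.keys (m + k). x v ^ Poly_Mapping.lookup (m + k) v) =
    (\<Prod>v\<in>Poly_Mapping.keys m. x v ^ Poly_Mapping.lookup m v) *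
    (\<Prod>v\<in>Poly_Mapping.keys k. x v ^ Poly_Mapping.lookup k v)"
proof -
  let ?S = "Poly_Mapping.keys m \<union> Poly_Mapping.keys k"
  have ext: "(\<Prod>v\<in>Poly_Mapping.keys l. x v ^ Poly_Mapping.lookup l v) =
      (\<Prod>v\<in>?S. x v ^ Poly_Mapping.lookup l v)"
    if "Poly_Mapping.keys l \<subseteq> ?S" for l :: "'v \<Rightarrow>\<^sub>0 nat"
    using that by (intro prod.mono_neutral_left) (auto simp: in_keys_iff)
  show ?thesis
    by (subst (1 2 3) ext) (simp_all add: keys_add lookup_add power_add prod.distrib)
qed

lemma eval_entry_poly_mult:
  "eval_entry_poly (p * q) A = eval_entry_poly p A * eval_entry_poly q A"
proof -
  let ?K = Poly_Mapping.keys and ?l = Poly_Mapping.lookup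
  let ?v = "\<lambda>m. \<Prod>v\<in>?K m. (A $$ v) ^ ?l m v"
  have "p * q = (\<Sum>m\<in>?K p. Poly_Mapping.single m (?l p m)) *
      (\<Sum>k\<in>?K q. Poly_Mapping.single k (?l q k))"
    using poly_mapping_sum_single[of p] poly_mapping_sum_single[of q] by simp
  also have "\<dots> = (\<Sum>m\<in>?K p. \<Sum>k\<in>?K q. Poly_Mapping.single (m + k) (?l p m * ?l q k))"
    by (simp add: sum_product mult_single)
  finally have "eval_entry_poly (p * q) A =
      (\<Sum>m\<in>?K p. \<Sum>k\<in>?K q. (?l p m * ?v m) * (?l q k * ?v k))"
    by (simp add: eval_entry_poly_sum eval_entry_poly_single monomial_value_add mult_ac)
  then show ?thesis
    by (simp add: eval_entry_poly_def sum_product)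
qed

lemma entry_poly_vars_add: "entry_poly_vars (p + q) \<subseteq> entry_poly_vars p \<union> entry_poly_vars q"
  unfolding entry_poly_vars_def using keys_add[of p q] by blast

lemma entry_poly_vars_mult: "entry_poly_vars (p * q) \<subseteq> entry_poly_vars p \<union> entry_poly_vars q"
proof
  fix v assume "v \<in> entry_poly_vars (p * q)"
  then obtain a b where "a \<in> Poly_Mapping.keys p" "b \<in> Poly_Mapping.keys q"
    "v \<in> Poly_Mapping.keys (a + b)"
    unfolding entry_poly_vars_def using keys_mult[of p q] by blast
  then show "v \<in> entry_poly_vars p \<union> entry_poly_vars q"
    unfolding entry_poly_vars_def using keys_add[of a b] by blast
qed

text \<open>
  Polynomial functions are generated inductively, so that closure under composition, evaluation by
  an \<open>entry_poly\<close> and restriction to a line each follow by one induction. The last rule makes the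
  notion depend only on the values on square matrices of size \<open>n\<close>; functions such as the determinant
  are given by a polynomial formula only there.
\<close>

inductive polynomial_fun :: "nat \<Rightarrow> (complex mat \<Rightarrow> complex) \<Rightarrow> bool" for n where
  const: "polynomial_fun n (\<lambda>A. c)"
| entry: "i < n \<Longrightarrow> j < n \<Longrightarrow> polynomial_fun n (\<lambda>A. A $$ (i, j))"
| add: "polynomial_fun n f \<Longrightarrow> polynomial_fun n g \<Longrightarrow> polynomial_fun n (\<lambda>A. f A + g A)"
| mult: "polynomial_fun n f \<Longrightarrow> polynomial_fun n g \<Longrightarrow> polynomial_fun n (\<lambda>A. f A * g A)"
| cong: "polynomial_fun n f \<Longrightarrow> (\<And>A. A \<in> carrier_mat n n \<Longrightarrow> g A = f A) \<Longrightarrow> polynomial_fun n g"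

lemma polynomial_fun_diff:
  assumes "polynomial_fun n f" "polynomial_fun n g"
  shows "polynomial_fun n (\<lambda>A. f A - g A)"
  by (rule polynomial_fun.cong[OF polynomial_fun.add[OF assms(1)
      polynomial_fun.mult[OF polynomial_fun.const[of n "-1"] assms(2)]]]) simp

lemma polynomial_fun_sum:
  assumes "\<And>i. i \<in> I \<Longrightarrow> polynomial_fun n (f i)"
  shows "polynomial_fun n (\<lambda>A. \<Sum>i\<in>I. f i A)"
  using assms
proof (induction I rule: infinite_finite_induct)
  case (insert i I)
  then show ?case using polynomial_fun.add[of n "f i" "\<lambda>A. \<Sum>i\<in>I. f i A"] by simp
qed (simp_all add: polynomial_fun.const)

lemma polynomial_fun_prod:
  assumes "\<And>i. i \<in> I \<Longrightarrow> polynomial_fun n (f i)"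
  shows "polynomial_fun n (\<lambda>A. \<Prod>i\<in>I. f i A)"
  using assms
proof (induction I rule: infinite_finite_induct)
  case (insert i I)
  then show ?case using polynomial_fun.mult[of n "f i" "\<lambda>A. \<Prod>i\<in>I. f i A"] by simp
qed (simp_all add: polynomial_fun.const)

text \<open>
  The two sizes may differ: cofactors involve matrices of size \<open>n - 1\<close>, and so does each step of
  Neville elimination.
\<close>

lemma polynomial_fun_comp:
  assumes "polynomial_fun k f"
    and carrier: "\<And>A. A \<in> carrier_mat n n \<Longrightarrow> G A \<in> carrier_mat k k"
    and entries: "\<And>i j. i < k \<Longrightarrow> j < k \<Longrightarrow> polynomial_fun n (\<lambda>A. G A $$ (i, j))"
  shows "polynomial_fun n (\<lambda>A. f (G A))"
  using assms(1)
proof induction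
  case (cong f g)
  then show ?case using carrier by (auto intro: polynomial_fun.cong)
qed (auto intro: polynomial_fun.intros(1-4) entries)

lemma polynomial_fun_det: "polynomial_fun n det"
proof (rule polynomial_fun.cong)
  show "polynomial_fun n (\<lambda>A. \<Sum>p\<in>{p. p permutes {0..<n}}.
      signof p * (\<Prod>i = 0..<n. A $$ (i, p i)))"
    by (intro polynomial_fun_sum polynomial_fun.mult polynomial_fun_prod polynomial_fun.const
        polynomial_fun.entry) (auto dest: permutes_in_image)
qed (simp add: det_def')

lemma polynomial_fun_adj_mat_entry:
  assumes "i < n" "j < n"
  shows "polynomial_fun n (\<lambda>A. adj_mat A $$ (i, j))"
proof (rule polynomial_fun.cong)
  have "polynomial_fun n (\<lambda>A. det (mat_delete A j i))"
  proof (rule polynomial_fun_comp[OF polynomial_fun_det])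
    fix a b assume ab: "a < n - 1" "b < n - 1"
    show "polynomial_fun n (\<lambda>A. mat_delete A j i $$ (a, b))"
    proof (rule polynomial_fun.cong)
      show "polynomial_fun n (\<lambda>A. A $$ (if a < j then a else Suc a, if b < i then b else Suc b))"
        using ab by (intro polynomial_fun.entry) auto
    qed (use ab in \<open>auto simp: mat_delete_def\<close>)
  qed (rule mat_delete_carrier)
  then show "polynomial_fun n (\<lambda>A. (-1) ^ (j + i) * det (mat_delete A j i))"
    by (intro polynomial_fun.mult polynomial_fun.const)
qed (use assms in \<open>auto simp: adj_mat_def cofactor_def\<close>)

lemma polynomial_fun_eval_entry_poly:
  assumes "polynomial_fun n f"
  shows "\<exists>p. entry_poly_vars p \<subseteq> {..<n} \<times> {..<n} \<and>
    (\<forall>A\<in>carrier_mat n n. f A = eval_entry_poly p A)"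
  using assms
proof induction
  case (const c)
  show ?case
    by (rule exI[of _ "Poly_Mapping.single 0 c"])
      (auto simp: entry_poly_vars_def eval_entry_poly_single split: if_splits)
next
  case (entry i j)
  then show ?case
    by (intro exI[of _ "Poly_Mapping.single (Poly_Mapping.single (i, j) 1) 1"])
      (auto simp: entry_poly_vars_def eval_entry_poly_single)
next
  case (add f g)
  then obtain p q where "entry_poly_vars p \<subseteq> {..<n} \<times> {..<n}" "entry_poly_vars q \<subseteq> {..<n} \<times> {..<n}"
    "\<forall>A\<in>carrier_mat n n. f A = eval_entry_poly p A" "\<forall>A\<in>carrier_mat n n. g A = eval_entry_poly q A"
    by blast
  then show ?case using entry_poly_vars_add[of p q]
    by (intro exI[of _ "p + q"]) (auto simp: eval_entry_poly_add)
next
  case (mult f g)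
  then obtain p q where "entry_poly_vars p \<subseteq> {..<n} \<times> {..<n}" "entry_poly_vars q \<subseteq> {..<n} \<times> {..<n}"
    "\<forall>A\<in>carrier_mat n n. f A = eval_entry_poly p A" "\<forall>A\<in>carrier_mat n n. g A = eval_entry_poly q A"
    by blast
  then show ?case using entry_poly_vars_mult[of p q]
    by (intro exI[of _ "p * q"]) (auto simp: eval_entry_poly_mult)
next
  case (cong f g)
  then show ?case by metis
qed

lemma holds_generically_if_polynomial_fun:
  assumes "polynomial_fun n f" and A0: "A0 \<in> carrier_mat n n" "f A0 \<noteq> 0"
    and Q: "\<And>A. A \<in> carrier_mat n n \<Longrightarrow> f A \<noteq> 0 \<Longrightarrow> Q A"
  shows "holds_generically n Q"
proof -
  obtain p where p: "entry_poly_vars p \<subseteq> {..<n} \<times> {..<n}"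
    "\<And>A. A \<in> carrier_mat n n \<Longrightarrow> f A = eval_entry_poly p A"
    using polynomial_fun_eval_entry_poly[OF assms(1)] by blast
  let ?Z = "{A \<in> carrier_mat n n. \<forall>q\<in>{p}. eval_entry_poly q A = 0}"
  have "algebraic_subvariety n ?Z"
    unfolding algebraic_subvariety_def using p(1) by (intro exI[of _ "{p}"]) auto
  moreover have "?Z \<subset> carrier_mat n n" using A0 p(2)[of A0] by auto
  moreover have "\<forall>A\<in>carrier_mat n n. \<not> Q A \<longrightarrow> A \<in> ?Z" using Q p(2) by auto
  ultimately show ?thesis unfolding holds_generically_def by blast
qed

text \<open>
  This reduces questions about zeros in many variables to the finiteness of the root set of a
  univariate polynomial.
\<close>

lemma polynomial_fun_on_line:
  assumes "polynomial_fun n f" and AB: "A \<in> carrier_mat n n" "B \<in> carrier_mat n n"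
  shows "\<exists>q :: complex poly. \<forall>t. f (A + t \<cdot>\<^sub>m (B - A)) = poly q t"
  using assms(1)
proof induction
  case (const c)
  show ?case by (rule exI[of _ "[:c:]"]) simp
next
  case (entry i j)
  then show ?case using AB
    by (intro exI[of _ "[:A $$ (i, j), B $$ (i, j) - A $$ (i, j):]"]) auto
next
  case (add f g)
  then show ?case by (metis poly_add)
next
  case (mult f g)
  then show ?case by (metis poly_mult)
next
  case (cong f g)
  moreover have "A + t \<cdot>\<^sub>m (B - A) \<in> carrier_mat n n" for t using AB by auto
  ultimately show ?case by metis
qed

text \<open>
  Irreducibility of the space of matrices: neither polynomial vanishes identically on the line
  through \<open>A\<close> and \<open>B\<close>, so their product has only finitely many zeros on it.
\<close>

lemma polynomial_fun_common_nonzero: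
  assumes f: "polynomial_fun n f" "A \<in> carrier_mat n n" "f A \<noteq> 0"
    and g: "polynomial_fun n g" "B \<in> carrier_mat n n" "g B \<noteq> 0"
  shows "\<exists>C\<in>carrier_mat n n. f C \<noteq> 0 \<and> g C \<noteq> 0"
proof -
  obtain p q where p: "\<And>t. f (A + t \<cdot>\<^sub>m (B - A)) = poly p t"
    and q: "\<And>t. g (A + t \<cdot>\<^sub>m (B - A)) = poly q t"
    using polynomial_fun_on_line[OF f(1) f(2) g(2)] polynomial_fun_on_line[OF g(1) f(2) g(2)]
    by blast
  have ends: "A + 0 \<cdot>\<^sub>m (B - A) = A" "A + 1 \<cdot>\<^sub>m (B - A) = B"
    using f(2) g(2) by (auto intro!: eq_matI)
  have "p \<noteq> 0" using p[of 0] f(3) ends by auto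
  moreover have "q \<noteq> 0" using q[of 1] g(3) ends by auto
  ultimately have "finite {t. poly (p * q) t = 0}" by (intro poly_roots_finite) simp
  then have "{t. poly (p * q) t = 0} \<noteq> UNIV" using infinite_UNIV_char_0 by metis
  then obtain t where "poly (p * q) t \<noteq> 0" by auto
  then show ?thesis using p q f(2) g(2)
    by (intro bexI[of _ "A + t \<cdot>\<^sub>m (B - A)"]) auto
qed

section \<open>Products of matrices\<close>

lemma mat_list_prod_carrier:
  assumes "\<forall>B\<in>set Bs. B \<in> carrier_mat n n"
  shows "mat_list_prod n Bs \<in> carrier_mat n n"
  using assms by (induction Bs) (auto simp: mat_list_prod_def)

lemma mat_list_prod_append:
  assumes "\<forall>B\<in>set Bs. B \<in> carrier_mat n n" "\<forall>C\<in>set Cs. C \<in> carrier_mat n n"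
  shows "mat_list_prod n (Bs @ Cs) = mat_list_prod n Bs * mat_list_prod n Cs"
  using assms(1)
proof (induction Bs)
  case Nil
  then show ?case using mat_list_prod_carrier[OF assms(2)] by (simp add: mat_list_prod_def)
next
  case (Cons B Bs)
  then show ?case
    using mat_list_prod_carrier[of Bs n] mat_list_prod_carrier[OF assms(2)]
    by (simp add: mat_list_prod_def assoc_mult_mat[of B n n _ n])
qed

lemma product_of_carrier: "product_of n k R A \<Longrightarrow> A \<in> carrier_mat n n"
  unfolding product_of_def by (auto intro: mat_list_prod_carrier)

lemma product_of_mult:
  assumes "product_of n k R A" "product_of n l R B"
  shows "product_of n (k + l) R (A * B)"
proof -
  obtain As Bs where "length As = k" "\<forall>B\<in>set As. B \<in> carrier_mat n n \<and> R B" "A = mat_list_prod n As"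
    "length Bs = l" "\<forall>B\<in>set Bs. B \<in> carrier_mat n n \<and> R B" "B = mat_list_prod n Bs"
    using assms unfolding product_of_def by blast
  then show ?thesis unfolding product_of_def
    by (intro exI[of _ "As @ Bs"]) (auto simp: mat_list_prod_append)
qed

lemma product_of_single:
  assumes "A \<in> carrier_mat n n" "R A"
  shows "product_of n 1 R A"
  unfolding product_of_def using assms
  by (intro exI[of _ "[A]"]) (simp add: mat_list_prod_def)

definition bordered :: "nat \<Rightarrow> complex \<Rightarrow> complex mat \<Rightarrow> complex mat" where
  "bordered n a T = four_block_mat (a \<cdot>\<^sub>m 1\<^sub>m 1) (0\<^sub>m 1 n) (0\<^sub>m n 1) T"

lemma bordered_carrier: "T \<in> carrier_mat n n \<Longrightarrow> bordered n a T \<in> carrier_mat (Suc n) (Suc n)"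
  unfolding bordered_def by auto

lemma bordered_index:
  assumes "T \<in> carrier_mat n n" "i < Suc n" "j < Suc n"
  shows "bordered n a T $$ (i, j) =
    (if i = 0 then if j = 0 then a else 0 else if j = 0 then 0 else T $$ (i - 1, j - 1))"
  using assms unfolding bordered_def by auto

lemma bordered_mult:
  assumes "S \<in> carrier_mat n n" "T \<in> carrier_mat n n"
  shows "bordered n a S * bordered n b T = bordered n (a * b) (S * T)"
proof -
  have "a \<cdot>\<^sub>m 1\<^sub>m 1 * (b \<cdot>\<^sub>m 1\<^sub>m 1) = (a * b) \<cdot>\<^sub>m (1\<^sub>m 1 :: complex mat)"
    by (rule eq_matI) (auto simp: scalar_prod_def)
  then show ?thesis unfolding bordered_def
    using assms by (subst mult_four_block_mat[of _ 1 1 _ n _ n _ _ 1 _ n])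
      (auto simp: left_add_zero_mat)
qed

lemma one_smult_mat: "(1 :: complex) \<cdot>\<^sub>m A = A"
  by (rule eq_matI) auto

lemma bordered_one: "bordered n c (c \<cdot>\<^sub>m 1\<^sub>m n) = c \<cdot>\<^sub>m 1\<^sub>m (Suc n)"
  by (rule eq_matI) (use bordered_carrier[of "c \<cdot>\<^sub>m 1\<^sub>m n" n c] in \<open>auto simp: bordered_index\<close>)

lemma tridiagonal_bordered:
  assumes "T \<in> carrier_mat n n" "tridiagonal_mat T"
  shows "tridiagonal_mat (bordered n a T)"
  using assms bordered_carrier[OF assms(1), of a]
  by (auto simp: tridiagonal_mat_def bordered_index)

text \<open>
  Bordering by the corner entry \<open>1\<close> is a monoid homomorphism.
\<close>

lemma product_of_bordered:
  assumes "product_of n k tridiagonal_mat T"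
  shows "product_of (Suc n) k tridiagonal_mat (bordered n 1 T)"
proof -
  obtain Bs where Bs: "length Bs = k" "\<forall>B\<in>set Bs. B \<in> carrier_mat n n \<and> tridiagonal_mat B"
    "T = mat_list_prod n Bs"
    using assms unfolding product_of_def by blast
  have "mat_list_prod (Suc n) (map (bordered n 1) Bs) = bordered n 1 (mat_list_prod n Bs)"
    using Bs(2)
  proof (induction Bs)
    case Nil
    show ?case using bordered_one[of n 1] by (simp add: mat_list_prod_def one_smult_mat)
  next
    case (Cons B Bs)
    then show ?case
      using bordered_mult[of B n "mat_list_prod n Bs" 1 1] mat_list_prod_carrier[of Bs n]
      by (simp add: mat_list_prod_def)
  qed
  then show ?thesis unfolding product_of_def
    using Bs by (intro exI[of _ "map (bordered n 1) Bs"])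
      (auto intro: tridiagonal_bordered bordered_carrier)
qed

section \<open>Neville elimination\<close>

text \<open>
  Left multiplication by this matrix keeps row \<open>0\<close> and replaces row \<open>i + 1\<close> by \<open>c i\<close> times itself
  minus \<open>c (i + 1)\<close> times row \<open>i\<close>. If \<open>c\<close> is the first column, this clears the first column below
  the corner without dividing.
\<close>

definition elim_mat :: "nat \<Rightarrow> (nat \<Rightarrow> complex) \<Rightarrow> complex mat" where
  "elim_mat n c = mat n n (\<lambda>(i, j).
     if i = 0 then (if j = 0 then 1 else 0)
     else if j = i then c (i - 1) else if Suc j = i then - c i else 0)"

lemma elim_mat_carrier[simp]: "elim_mat n c \<in> carrier_mat n n"
  by (simp add: elim_mat_def)

lemma elim_mat_dim[simp]: "dim_row (elim_mat n c) = n" "dim_col (elim_mat n c) = n"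
  by (simp_all add: elim_mat_def)

lemma elim_mat_row_sum:
  assumes "i < n"
  shows "(\<Sum>k<n. elim_mat n c $$ (i, k) * x k) =
    (case i of 0 \<Rightarrow> x 0 | Suc h \<Rightarrow> c h * x (Suc h) - c (Suc h) * x h)"
proof (cases i)
  case 0
  have "(\<Sum>k<n. elim_mat n c $$ (i, k) * x k) = (\<Sum>k<n. if k = 0 then x k else 0)"
    using assms 0 by (intro sum.cong) (auto simp: elim_mat_def)
  then show ?thesis using assms 0 by (simp add: sum.delta)
next
  case (Suc h)
  have "(\<Sum>k<n. elim_mat n c $$ (i, k) * x k) =
      (\<Sum>k<n. (if k = i then c h * x k else 0) + (if k = h then - (c i * x k) else 0))"
    using assms Suc by (intro sum.cong) (auto simp: elim_mat_def)
  then show ?thesis using assms Suc by (simp add: sum.distrib sum.delta)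
qed

lemma elim_mat_mult_index:
  assumes "X \<in> carrier_mat n n" "i < n" "j < n"
  shows "(elim_mat n c * X) $$ (i, j) =
    (case i of 0 \<Rightarrow> X $$ (0, j) | Suc h \<Rightarrow> c h * X $$ (Suc h, j) - c (Suc h) * X $$ (h, j))"
proof -
  have "(elim_mat n c * X) $$ (i, j) = (\<Sum>k<n. elim_mat n c $$ (i, k) * X $$ (k, j))"
    using assms by (simp add: scalar_prod_def atLeast0LessThan)
  then show ?thesis by (simp only: elim_mat_row_sum[OF assms(2)])
qed

lemma mult_elim_mat_transpose_index:
  assumes "X \<in> carrier_mat n n" "i < n" "j < n"
  shows "(X * transpose_mat (elim_mat n c)) $$ (i, j) =
    (case j of 0 \<Rightarrow> X $$ (i, 0) | Suc h \<Rightarrow> c h * X $$ (i, Suc h) - c (Suc h) * X $$ (i, h))"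
proof -
  have "(X * transpose_mat (elim_mat n c)) $$ (i, j) = (\<Sum>k<n. elim_mat n c $$ (j, k) * X $$ (i, k))"
    using assms
    by (simp add: scalar_prod_def atLeast0LessThan mult.commute)
  then show ?thesis by (simp only: elim_mat_row_sum[OF assms(3)])
qed

lemma det_elim_mat_nonzero:
  assumes "\<And>i. i < n \<Longrightarrow> c i \<noteq> 0"
  shows "det (elim_mat n c) \<noteq> 0"
proof -
  have "det (elim_mat n c) = prod_list (diag_mat (elim_mat n c))"
    by (rule det_lower_triangular[of n]) (auto simp: elim_mat_def)
  also have "\<dots> \<noteq> 0"
    using assms by (auto simp: prod_list_zero_iff diag_mat_def elim_mat_def)
  finally show ?thesis .
qed

text \<open>
  The lower right block of \<open>M\<close> after the first column has been cleared by row operations and then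
  the first row by column operations.
\<close>

definition neville_step :: "nat \<Rightarrow> complex mat \<Rightarrow> complex mat" where
  "neville_step n M = mat n n (\<lambda>(i, j).
     M $$ (0, j) * (M $$ (i, 0) * M $$ (Suc i, Suc j) - M $$ (Suc i, 0) * M $$ (i, Suc j)) -
     M $$ (0, Suc j) * (M $$ (i, 0) * M $$ (Suc i, j) - M $$ (Suc i, 0) * M $$ (i, j)))"

lemma neville_step_carrier[simp]: "neville_step n M \<in> carrier_mat n n"
  by (simp add: neville_step_def)

lemma neville_step_factorization:
  assumes M: "M \<in> carrier_mat (Suc n) (Suc n)"
  shows "elim_mat (Suc n) (\<lambda>i. M $$ (i, 0)) * M * transpose_mat (elim_mat (Suc n) (\<lambda>j. M $$ (0, j)))
    = bordered n (M $$ (0, 0)) (neville_step n M)" (is "?E * M * ?F = ?B")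
proof (rule eq_matI)
  have B: "?B \<in> carrier_mat (Suc n) (Suc n)" by (simp add: bordered_carrier)
  have EM: "?E * M \<in> carrier_mat (Suc n) (Suc n)" using M by (intro mult_carrier_mat) auto
  show "dim_row (?E * M * ?F) = dim_row ?B" "dim_col (?E * M * ?F) = dim_col ?B"
    using B by (auto simp: elim_mat_def)
  fix i j assume "i < dim_row ?B" "j < dim_col ?B"
  then have ij: "i < Suc n" "j < Suc n" using B by auto
  show "(?E * M * ?F) $$ (i, j) = ?B $$ (i, j)"
    using ij M
    by (auto simp: mult_elim_mat_transpose_index[OF EM] elim_mat_mult_index bordered_index
        neville_step_def simp del: index_mult_mat split: nat.split)
qed

text \<open>
  If this product is nonzero, then at every step the row operations are invertible and the corner
  entry is nonzero. Invertibility of the column operations is implicit: if they were singular, the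
  remaining matrix would be singular too, and a later factor would vanish.
\<close>

primrec neville_pivots :: "nat \<Rightarrow> complex mat \<Rightarrow> complex" where
  "neville_pivots 0 M = 1"
| "neville_pivots (Suc n) M = (\<Prod>i\<le>n. M $$ (i, 0)) * neville_pivots n (neville_step n M)"

lemma polynomial_fun_neville_pivots: "polynomial_fun n (neville_pivots n)"
proof (induction n)
  case 0
  then show ?case by (simp add: polynomial_fun.const)
next
  case (Suc n)
  have "polynomial_fun (Suc n) (\<lambda>M. neville_pivots n (neville_step n M))"
    using Suc
  proof (rule polynomial_fun_comp)
    fix i j assume "i < n" "j < n"
    then show "polynomial_fun (Suc n) (\<lambda>M. neville_step n M $$ (i, j))"
      by (simp add: neville_step_def)
        (intro polynomial_fun_diff polynomial_fun.mult polynomial_fun.entry; simp)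
  qed simp
  then show ?case
    by (simp, intro polynomial_fun.mult polynomial_fun_prod polynomial_fun.entry) auto
qed

lemma tridiagonal_elim_mat_transpose_mult_bordered:
  "tridiagonal_mat (transpose_mat (elim_mat (Suc n) c) * bordered n a (1\<^sub>m n))"
proof -
  let ?F = "transpose_mat (elim_mat (Suc n) c)" and ?D = "bordered n a (1\<^sub>m n)"
  have D: "?D \<in> carrier_mat (Suc n) (Suc n)" by (simp add: bordered_carrier)
  have "(?F * ?D) $$ (i, j) = 0" if "i < Suc n" "j < Suc n" "\<bar>int i - int j\<bar> \<ge> 2" for i j
  proof -
    have "(?F * ?D) $$ (i, j) = (\<Sum>k<Suc n. ?F $$ (i, k) * ?D $$ (k, j))"
      using that D by (simp add: scalar_prod_def atLeast0LessThan del: sum.lessThan_Suc)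
    also have "\<dots> = 0"
      using that by (intro sum.neutral) (auto simp: bordered_index elim_mat_def)
    finally show ?thesis .
  qed
  then show ?thesis using D unfolding tridiagonal_mat_def by auto
qed

text \<open>
  With \<open>M\<close> an adjugate, the matrices of interest are scalar multiples of its inverse. The scalar
  enters the factors through the corner entry \<open>c / a\<close> at each step.
\<close>

lemma smult_inverse_product_if_neville_pivots:
  assumes "M \<in> carrier_mat n n" "neville_pivots n M \<noteq> 0"
  shows "\<exists>B. M * B = c \<cdot>\<^sub>m 1\<^sub>m n \<and> product_of n (2 * n) tridiagonal_mat B"
  using assms
proof (induction n arbitrary: M)
  case 0
  show ?case
    by (rule exI[of _ "1\<^sub>m 0"], rule conjI, rule eq_matI)
      (use 0 in \<open>auto simp: product_of_def mat_list_prod_def\<close>)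
next
  case (Suc n)
  define E where "E = elim_mat (Suc n) (\<lambda>i. M $$ (i, 0))"
  define F where "F = transpose_mat (elim_mat (Suc n) (\<lambda>j. M $$ (0, j)))"
  define a where "a = M $$ (0, 0)"
  define N where "N = neville_step n M"
  have col: "M $$ (i, 0) \<noteq> 0" if "i < Suc n" for i
    using Suc.prems(2) that by auto
  obtain B where B: "N * B = c \<cdot>\<^sub>m 1\<^sub>m n" "product_of n (2 * n) tridiagonal_mat B"
    using Suc.IH[of N] Suc.prems(2) unfolding N_def by auto
  define D where "D = bordered n (c / a) (1\<^sub>m n)"
  define B' where "B' = F * D * bordered n 1 B * E"
  have Bc: "B \<in> carrier_mat n n" using product_of_carrier[OF B(2)] .
  have Nc: "N \<in> carrier_mat n n" by (simp add: N_def)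
  note M = Suc.prems(1)
  have car: "E \<in> carrier_mat (Suc n) (Suc n)" "F \<in> carrier_mat (Suc n) (Suc n)"
    "D \<in> carrier_mat (Suc n) (Suc n)" "bordered n 1 B \<in> carrier_mat (Suc n) (Suc n)"
    by (auto simp: E_def F_def D_def Bc intro: bordered_carrier)
  \<comment> \<open>The diagonal factor \<open>D\<close> is merged with \<open>F\<close> into one tridiagonal matrix.\<close>
  have "product_of (Suc n) (1 + 2 * n + 1) tridiagonal_mat B'"
    unfolding B'_def
  proof (intro product_of_mult product_of_single product_of_bordered B(2))
    show "tridiagonal_mat (F * D)"
      unfolding F_def D_def by (rule tridiagonal_elim_mat_transpose_mult_bordered)
    show "tridiagonal_mat E"
      unfolding E_def by (auto simp: tridiagonal_mat_def elim_mat_def)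
  qed (use car in auto)
  moreover have "M * B' = c \<cdot>\<^sub>m 1\<^sub>m (Suc n)"
  proof -
    \<comment> \<open>It suffices to verify the identity after multiplication by the invertible matrix \<open>E\<close>.\<close>
    have "E * (M * B') = (E * M * F) * (D * bordered n 1 B) * E"
      unfolding B'_def using car M by (simp add: assoc_mult_mat[of _ "Suc n" "Suc n" _ "Suc n" _ "Suc n"])
    also have "D * bordered n 1 B = bordered n (c / a) B"
      using Bc by (simp add: D_def bordered_mult)
    also have "E * M * F = bordered n a N"
      unfolding E_def F_def a_def N_def by (rule neville_step_factorization[OF M])
    also have "bordered n a N * bordered n (c / a) B = c \<cdot>\<^sub>m 1\<^sub>m (Suc n)"
      using Nc Bc col[of 0] by (simp add: bordered_mult B(1) a_def bordered_one)
    finally have EMB: "E * (M * B') = c \<cdot>\<^sub>m E"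
      using car mult_smult_assoc_mat[of "1\<^sub>m (Suc n)" "Suc n" "Suc n" E "Suc n" c] by simp
    have "det E \<noteq> 0" unfolding E_def using col by (intro det_elim_mat_nonzero) auto
    then obtain G where G: "G \<in> carrier_mat (Suc n) (Suc n)" "G * E = 1\<^sub>m (Suc n)"
      using det_non_zero_imp_unit[OF car(1)]
      by (auto simp: Units_def ring_mat_def)
    have MB: "M * B' \<in> carrier_mat (Suc n) (Suc n)"
      unfolding B'_def using car M by auto
    have "M * B' = G * (E * (M * B'))"
      using assoc_mult_mat[OF G(1) car(1) MB] G(2) left_mult_one_mat[OF MB] by simp
    also have "\<dots> = c \<cdot>\<^sub>m 1\<^sub>m (Suc n)"
      unfolding EMB using G car by (simp add: mult_smult_distrib[OF G(1) car(1)])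
    finally show ?thesis .
  qed
  ultimately show ?case by (intro exI[of _ B']) simp
qed

text \<open>
  Since \<open>M\<close> is invertible, \<open>A\<close> is the matrix \<open>c M\<^sup>-\<^sup>1\<close> constructed before.
\<close>

lemma product_if_smult_inverse:
  assumes M: "M \<in> carrier_mat n n" "neville_pivots n M \<noteq> 0"
    and A: "A \<in> carrier_mat n n" "M * A = c \<cdot>\<^sub>m 1\<^sub>m n"
  shows "product_of n (2 * n) tridiagonal_mat A"
proof -
  obtain G where "M * G = 1 \<cdot>\<^sub>m 1\<^sub>m n" "product_of n (2 * n) tridiagonal_mat G"
    using smult_inverse_product_if_neville_pivots[OF M, of 1] by blast
  then have G: "G \<in> carrier_mat n n" "G * M = 1\<^sub>m n"
    using mat_mult_left_right_inverse[OF M(1), of G] product_of_carrier by (auto simp: one_smult_mat)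
  obtain B where B: "M * B = c \<cdot>\<^sub>m 1\<^sub>m n" "product_of n (2 * n) tridiagonal_mat B"
    using smult_inverse_product_if_neville_pivots[OF M, of c] by blast
  have "A = G * (M * A)"
    using assoc_mult_mat[OF G(1) M(1) A(1)] G A(1) by simp
  also have "\<dots> = G * (M * B)" using A(2) B(1) by simp
  also have "\<dots> = B"
    using assoc_mult_mat[OF G(1) M(1) product_of_carrier[OF B(2)]] G product_of_carrier[OF B(2)]
    by simp
  finally show ?thesis using B(2) by simp
qed

section \<open>The Pascal matrix\<close>

definition pascal_mat :: "nat \<Rightarrow> complex mat" where
  "pascal_mat n = mat n n (\<lambda>(i, j). of_nat ((i + j) choose i))"

text \<open>
  The first row and column of the Pascal matrix are constant, so a step takes differences of
  neighbours in both directions, and Pascal's rule applied twice returns the Pascal matrix. The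
  scalar is included because an adjugate is an inverse only up to the determinant.
\<close>

lemma neville_step_smult_pascal:
  "neville_step n (c \<cdot>\<^sub>m pascal_mat (Suc n)) = c ^ 3 \<cdot>\<^sub>m pascal_mat n"
  by (rule eq_matI) (auto simp: neville_step_def pascal_mat_def algebra_simps power3_eq_cube)

lemma neville_pivots_smult_pascal:
  "c \<noteq> 0 \<Longrightarrow> neville_pivots n (c \<cdot>\<^sub>m pascal_mat n) \<noteq> 0"
proof (induction n arbitrary: c)
  case (Suc n)
  have "neville_pivots n (c ^ 3 \<cdot>\<^sub>m pascal_mat n) \<noteq> 0" using Suc by auto
  moreover have "(c \<cdot>\<^sub>m pascal_mat (Suc n)) $$ (i, 0) \<noteq> 0" if "i \<le> n" for i
    using that Suc.prems by (simp add: pascal_mat_def)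
  ultimately show ?case by (simp add: neville_step_smult_pascal)
qed simp

lemma pascal_mat_carrier: "pascal_mat n \<in> carrier_mat n n"
  by (simp add: pascal_mat_def)

lemma pascal_mat_inverse:
  obtains G where "G \<in> carrier_mat n n" "pascal_mat n * G = 1\<^sub>m n" "G * pascal_mat n = 1\<^sub>m n"
proof -
  have "neville_pivots n (pascal_mat n) \<noteq> 0"
    using neville_pivots_smult_pascal[of 1 n] by (simp add: one_smult_mat)
  then obtain G where "pascal_mat n * G = 1\<^sub>m n" "G \<in> carrier_mat n n"
    using smult_inverse_product_if_neville_pivots[OF pascal_mat_carrier, of n 1] product_of_carrier
    by (auto simp: one_smult_mat)
  then show thesis
    using that mat_mult_left_right_inverse[OF pascal_mat_carrier] by blast
qed

section \<open>Generic and arbitrary invertible matrices\<close>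

lemma adj_mat_eq_smult_inverse:
  fixes A :: "'a::field mat"
  assumes A: "A \<in> carrier_mat n n" "B \<in> carrier_mat n n" "A * B = 1\<^sub>m n"
  shows "adj_mat A = det A \<cdot>\<^sub>m B" "det A \<noteq> 0"
proof -
  note adj = adj_mat[OF A(1)]
  have "adj_mat A = adj_mat A * (A * B)" using adj(1) A(3) by simp
  also have "\<dots> = (det A \<cdot>\<^sub>m 1\<^sub>m n) * B" using assoc_mult_mat[OF adj(1) A(1,2)] adj(3) by simp
  also have "\<dots> = det A \<cdot>\<^sub>m B" using A(2) mult_smult_assoc_mat[of "1\<^sub>m n" n n B n "det A"] by simp
  finally show "adj_mat A = det A \<cdot>\<^sub>m B" .
  show "det A \<noteq> 0" using det_mult[OF A(1,2)] A(3) by auto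
qed

lemma generic_product: "holds_generically n (product_of n (2 * n) tridiagonal_mat)"
proof -
  obtain G where G: "G \<in> carrier_mat n n" "G * pascal_mat n = 1\<^sub>m n"
    using pascal_mat_inverse by blast
  note adjG = adj_mat_eq_smult_inverse[OF G(1) pascal_mat_carrier G(2)]
  show ?thesis
  proof (rule holds_generically_if_polynomial_fun)
    show "polynomial_fun n (\<lambda>A. neville_pivots n (adj_mat A))"
      by (rule polynomial_fun_comp[OF polynomial_fun_neville_pivots])
        (auto intro: adj_mat(1) polynomial_fun_adj_mat_entry)
    show "neville_pivots n (adj_mat G) \<noteq> 0"
      using adjG neville_pivots_smult_pascal by simp
    fix A :: "complex mat"
    assume "A \<in> carrier_mat n n" "neville_pivots n (adj_mat A) \<noteq> 0"
    then show "product_of n (2 * n) tridiagonal_mat A"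
      using product_if_smult_inverse[of "adj_mat A"] adj_mat[of A n] by blast
  qed (rule G(1))
qed

text \<open>
  Write \<open>X\<close> for the inverse of \<open>A\<close>. The two conditions on \<open>Y\<close> are that \<open>Y\<close> and \<open>adj Y \<cdot> X\<close> have
  nonzero pivots. Each of them can be met alone: the first by the Pascal matrix \<open>P\<close>, the second by
  \<open>X P\<^sup>-\<^sup>1\<close>, whose adjugate times \<open>X\<close> is a nonzero multiple of \<open>P\<close>.
\<close>

lemma invertible_product:
  assumes A: "A \<in> carrier_mat n n" "invertible_mat A"
  shows "product_of n (4 * n) tridiagonal_mat A"
proof -
  let ?P = "pascal_mat n"
  note P = pascal_mat_carrier[of n]
  obtain X where X: "X \<in> carrier_mat n n" "X * A = 1\<^sub>m n" "A * X = 1\<^sub>m n"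
    using A unfolding invertible_mat_def inverts_mat_def
    by (metis carrier_matD carrier_matI index_mult_mat(2,3) index_one_mat(2,3))
  obtain G where G: "G \<in> carrier_mat n n" "?P * G = 1\<^sub>m n" "G * ?P = 1\<^sub>m n"
    using pascal_mat_inverse by blast
  define h where "h = (\<lambda>Y. neville_pivots n (adj_mat Y * X))"
  have "polynomial_fun n h"
    unfolding h_def
  proof (rule polynomial_fun_comp[OF polynomial_fun_neville_pivots])
    fix i j assume ij: "i < n" "j < n"
    show "polynomial_fun n (\<lambda>Y. (adj_mat Y * X) $$ (i, j))"
    proof (rule polynomial_fun.cong)
      show "polynomial_fun n (\<lambda>Y. \<Sum>k<n. adj_mat Y $$ (i, k) * X $$ (k, j))"
        using ij by (intro polynomial_fun_sum polynomial_fun.mult polynomial_fun_adj_mat_entry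
            polynomial_fun.const) auto
      fix Y :: "complex mat" assume "Y \<in> carrier_mat n n"
      then have "adj_mat Y \<in> carrier_mat n n" by (rule adj_mat(1))
      then show "(adj_mat Y * X) $$ (i, j) = (\<Sum>k<n. adj_mat Y $$ (i, k) * X $$ (k, j))"
        using ij X(1) by (simp add: scalar_prod_def atLeast0LessThan)
    qed
  qed (rule mult_carrier_mat[OF adj_mat(1) X(1)])
  moreover have "h (X * G) \<noteq> 0"
  proof -
    have "(X * G) * (?P * A) = X * ((G * ?P) * A)"
      using X(1) G(1) P A(1) by (simp add: assoc_mult_mat[of _ n n _ n _ n])
    also have "\<dots> = 1\<^sub>m n" using G X A by simp
    finally have adj: "adj_mat (X * G) = det (X * G) \<cdot>\<^sub>m (?P * A)" "det (X * G) \<noteq> 0"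
      using adj_mat_eq_smult_inverse[of "X * G" n "?P * A"] X(1) G(1) P A(1) by auto
    have "(?P * A) * X = ?P * (A * X)"
      using X(1) P A(1) by (simp add: assoc_mult_mat[of _ n n _ n _ n])
    then have "adj_mat (X * G) * X = det (X * G) \<cdot>\<^sub>m ?P"
      using adj(1) X P A(1) mult_smult_assoc_mat[of "?P * A" n n X n "det (X * G)"] by simp
    then show ?thesis using adj(2) neville_pivots_smult_pascal by (simp add: h_def)
  qed
  moreover have "neville_pivots n ?P \<noteq> 0"
    using neville_pivots_smult_pascal[of 1 n] by (simp add: one_smult_mat)
  ultimately obtain Y where Y: "Y \<in> carrier_mat n n" "neville_pivots n Y \<noteq> 0" "h Y \<noteq> 0"
    using polynomial_fun_common_nonzero[OF polynomial_fun_neville_pivots P, of h "X * G"] X(1) G(1)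
    by auto
  obtain Z where Z: "Y * Z = 1\<^sub>m n" "product_of n (2 * n) tridiagonal_mat Z"
    using smult_inverse_product_if_neville_pivots[OF Y(1,2), of 1] by (auto simp: one_smult_mat)
  note adjY = adj_mat[OF Y(1)]
  have "adj_mat Y * X * (A * Y) = adj_mat Y * ((X * A) * Y)"
    using adjY(1) X(1) A(1) Y(1) by (simp add: assoc_mult_mat[of _ n n _ n _ n])
  also have "\<dots> = det Y \<cdot>\<^sub>m 1\<^sub>m n" using X(2) Y(1) adjY(3) by simp
  finally have "product_of n (2 * n) tridiagonal_mat (A * Y)"
    using product_if_smult_inverse[of "adj_mat Y * X" n "A * Y" "det Y"] adjY(1) X(1) A(1) Y(1,3)
    by (auto simp: h_def)
  from product_of_mult[OF this Z(2)] have "product_of n (4 * n) tridiagonal_mat (A * Y * Z)" by simp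
  moreover have "A * Y * Z = A"
    using assoc_mult_mat[OF A(1) Y(1) product_of_carrier[OF Z(2)]] Z(1) A(1) by simp
  ultimately show ?thesis by simp
qed

theorem proposition5p3:
  fixes n :: nat
  assumes "n \<ge> 1"
  shows "holds_generically n (product_of n (2 * n) tridiagonal_mat) \<and>
    (\<forall>A \<in> (carrier_mat n n :: complex mat set). invertible_mat A \<longrightarrow> product_of n (4 * n) bidiagonal_mat A)"
  using generic_product invertible_product by blast

end
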